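(* Consider the relevance vector machine (RVM) with hyperparameters $a,b,c,d\in\mathbb{R}$ described in the context, and suppose $b=0$, i.e. $\pi(\lambda_i)\propto\lambda_i^{a-1}$ for all $i=0,1,\dots,n$. Then, for any choice of the prior $\pi(1/\sigma^2)\propto (1/\sigma^2)^{c-1}\exp\{-d/\sigma^2\}$ on $1/\sigma^2$, that is, for all $c,d\in\mathbb{R}$, a necessary condition for the propriety of the posterior density $\pi(\beta,1/\sigma^2,\lambda\mid y)$ is $a\in(-1/2,0)$. In other words, if $m(y)<\infty$ then $-1/2<a<0$.
   Context: Data: $(y_i,x_i)$, $i=1,\dots,n$, with $y_i\in\mathbb{R}$, $x_i\in\mathbb{R}^p$; $y=(y_1,\dots,y_n)^T$. Let $k_\theta(\cdot,\cdot)$ be a (real-valued) reproducing kernel with fixed kernel parameter $\theta$, and let $K$ be the $n\times(n+1)$ matrix whose $i$-th row is $\big(1,k_\theta(x_i,x_1),k_\theta(x_i,x_2),\dots,k_\theta(x_i,x_n)\big)$. Write $\beta=(\beta_0,\dots,\beta_n)^T\in\mathbb{R}^{n+1}$, $\lambda=(\lambda_0,\dots,\lambda_n)^T\in\mathbb{R}_+^{n+1}$, $\mathbb{R}_+=(0,\infty)$, $D=\mathrm{diag}(\lambda_0,\dots,\lambda_n)$. The RVM with hyperparameters $a,b,c,d\in\mathbb{R}$ is the hierarchical model $$y\mid\beta,\sigma^2\sim N(K\beta,\sigma^2 I),\qquad \beta\mid\lambda\sim N(0,D^{-1}),$$ $$\pi(\lambda_i)\propto\lambda_i^{a-1}\exp\{-b\lambda_i\}\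 (i=0,\dots,n),\qquad \pi\Big(\frac1{\sigma^2}\Big)\propto\Big(\frac1{\sigma^2}\Big)^{c-1}\exp\Big\{-\frac{d}{\sigma^2}\Big\},$$ where $\sigma^2,\lambda_0,\dots,\lambda_n$ are a priori independent and $\beta$ and $\sigma^2$ are a priori independent. The priors on $\lambda_i$ and $1/\sigma^2$ are allowed to be improper (not integrable). The joint prior is the product $\pi(\beta,1/\sigma^2,\lambda)=\pi(\beta\mid\lambda)\,\pi(1/\sigma^2)\prod_{i=0}^n\pi(\lambda_i)$, with $\pi(\beta\mid\lambda)$ the $N(0,D^{-1})$ density. With $f(y\mid\beta,\sigma^2)$ the $N(K\beta,\sigma^2I)$ density, define $$m(y)=\int_{\mathbb{R}_+^{n+1}}\int_{\mathbb{R}_+}\int_{\mathbb{R}^{n+1}} f(y\mid\beta,\sigma^2)\,\pi(\beta,1/\sigma^2,\lambda)\,d\beta\,d\tfrac{1}{\sigma^2}\,d\lambda,$$ and the posterior density $\pi(\beta,1/\sigma^2,\lambda\mid y)=f(y\mid\beta,\sigma^2)\pi(\beta,1/\sigma^2,\lambda)/m(y)$. The posterior density is proper if and only if $m(y)<\infty$. *)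

theory Defs
  imports "HOL-Analysis.Analysis"
begin

definition inner_product_on ::
  "('x \<Rightarrow> real) set \<Rightarrow> (('x \<Rightarrow> real) \<Rightarrow> ('x \<Rightarrow> real) \<Rightarrow> real) \<Rightarrow> bool" where
  "inner_product_on H ip \<longleftrightarrow>
     (\<forall>f\<in>H. \<forall>g\<in>H. ip f g = ip g f) \<and>
     (\<forall>f\<in>H. \<forall>g\<in>H. \<forall>h\<in>H. ip (\<lambda>t. f t + g t) h = ip f h + ip g h) \<and>
     (\<forall>f\<in>H. \<forall>g\<in>H. \<forall>r. ip (\<lambda>t. r * f t) g = r * ip f g) \<and>
     (\<forall>f\<in>H. 0 \<le> ip f f) \<and>
     (\<forall>f\<in>H. ip f f = 0 \<longrightarrow> f = (\<lambda>t. 0))"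

definition hilbert_function_space ::
  "('x \<Rightarrow> real) set \<Rightarrow> (('x \<Rightarrow> real) \<Rightarrow> ('x \<Rightarrow> real) \<Rightarrow> real) \<Rightarrow> bool" where
  "hilbert_function_space H ip \<longleftrightarrow>
     (\<lambda>t. 0) \<in> H \<and>
     (\<forall>f\<in>H. \<forall>g\<in>H. (\<lambda>t. f t + g t) \<in> H) \<and>
     (\<forall>f\<in>H. \<forall>r. (\<lambda>t. r * f t) \<in> H) \<and>
     inner_product_on H ip \<and>
     (let d = (\<lambda>f g. sqrt (ip (\<lambda>t. f t - g t) (\<lambda>t. f t - g t))) in
        \<forall>F :: nat \<Rightarrow> 'x \<Rightarrow> real.
          (\<forall>m. F m \<in> H) \<and> (\<forall>e>0. \<exists>N. \<forall>m\<ge>N. \<forall>l\<ge>N. d (F m) (F l) < e) \<longrightarrow>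
          (\<exists>g\<in>H. (\<lambda>m. d (F m) g) \<longlonglongrightarrow> 0))"

definition reproducing_kernel :: "('x \<Rightarrow> 'x \<Rightarrow> real) \<Rightarrow> bool" where
  "reproducing_kernel k \<longleftrightarrow>
     (\<exists>H ip. hilbert_function_space H ip \<and>
        (\<forall>z. (\<lambda>t. k t z) \<in> H \<and> (\<forall>f\<in>H. f z = ip f (\<lambda>t. k t z))))"

text \<open>Columns are indexed by \<open>'n option\<close>: \<open>None\<close> is the intercept index \<open>0\<close>, and \<open>Some l\<close>
  is the index of the \<open>l\<close>-th observation, so \<open>real ^ 'n option\<close> is the space of dimension \<open>n + 1\<close>.\<close>

definition design_matrix ::
  "('x \<Rightarrow> 'x \<Rightarrow> real) \<Rightarrow> ('n::finite \<Rightarrow> 'x) \<Rightarrow> real ^ 'n option ^ 'n" where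
  "design_matrix k x = (\<chi> i j. case j of None \<Rightarrow> 1 | Some l \<Rightarrow> k (x i) (x l))"

definition diag_matrix :: "real ^ 'm \<Rightarrow> real ^ 'm ^ 'm" where
  "diag_matrix v = (\<chi> i j. if i = j then v $ i else 0)"

text \<open>Lebesgue density at \<open>v\<close> of the normal law with mean \<open>\<mu>\<close> and (positive definite)
  covariance matrix \<open>S\<close>.\<close>

definition mvn_density :: "real ^ 'm \<Rightarrow> real ^ 'm ^ 'm \<Rightarrow> real ^ 'm \<Rightarrow> real" where
  "mvn_density \<mu> S v =
     exp (- ((v - \<mu>) \<bullet> (matrix_inv S *v (v - \<mu>))) / 2) / sqrt ((2 * pi) ^ CARD('m) * det S)"

text \<open>The constant is arbitrary because improper priors have no canonical normalisation.\<close>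

definition proportional_on :: "'s set \<Rightarrow> ('s \<Rightarrow> real) \<Rightarrow> ('s \<Rightarrow> real) \<Rightarrow> bool" where
  "proportional_on A f g \<longleftrightarrow> (\<exists>C>0. \<forall>t\<in>A. f t = C * g t)"

definition gamma_prior :: "real \<Rightarrow> real \<Rightarrow> (real \<Rightarrow> real) \<Rightarrow> bool" where
  "gamma_prior r s \<pi> \<longleftrightarrow> proportional_on {0<..} \<pi> (\<lambda>t. t powr (r - 1) * exp (- s * t))"

definition rvm_likelihood ::
  "real ^ 'n option ^ 'n \<Rightarrow> real ^ 'n \<Rightarrow> real ^ 'n option \<Rightarrow> real \<Rightarrow> real" where
  "rvm_likelihood K y \<beta> \<sigma>2 = mvn_density (K *v \<beta>) (\<sigma>2 *\<^sub>R mat 1) y"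

definition rvm_prior ::
  "('m \<Rightarrow> real \<Rightarrow> real) \<Rightarrow> (real \<Rightarrow> real) \<Rightarrow> real ^ 'm \<Rightarrow> real \<Rightarrow> real ^ 'm \<Rightarrow> real" where
  "rvm_prior p_lam p_tau \<beta> \<tau> lam =
     mvn_density 0 (matrix_inv (diag_matrix lam)) \<beta> * p_tau \<tau> * (\<Prod>i\<in>UNIV. p_lam i (lam $ i))"

text \<open>The integration variable \<open>\<tau>\<close> is the precision \<open>1 / \<sigma>\<^sup>2\<close>.\<close>

definition rvm_marginal ::
  "real ^ 'n option ^ 'n \<Rightarrow> ('n option \<Rightarrow> real \<Rightarrow> real) \<Rightarrow> (real \<Rightarrow> real) \<Rightarrow> real ^ 'n \<Rightarrow> ennreal"
  where
  "rvm_marginal K p_lam p_tau y =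
     (\<integral>\<^sup>+lam\<in>{lam. \<forall>i. 0 < lam $ i}. (\<integral>\<^sup>+\<tau>\<in>{0<..}. (\<integral>\<^sup>+\<beta>.
        ennreal (rvm_likelihood K y \<beta> (1 / \<tau>) * rvm_prior p_lam p_tau \<beta> \<tau> lam)
      \<partial>lborel) \<partial>lborel) \<partial>lborel)"

text \<open>The posterior density is likelihood times prior divided by the marginal, so it is a
  (normalisable) density exactly when the marginal is finite.\<close>

definition rvm_posterior_proper ::
  "real ^ 'n option ^ 'n \<Rightarrow> ('n option \<Rightarrow> real \<Rightarrow> real) \<Rightarrow> (real \<Rightarrow> real) \<Rightarrow> real ^ 'n \<Rightarrow> bool"
  where
  "rvm_posterior_proper K p_lam p_tau y \<longleftrightarrow> rvm_marginal K p_lam p_tau y < \<infinity>"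

end

theory Submission
  imports Defs
begin

text \<open>
  With \<open>b = 0\<close> the prior on each precision is a pure power, so the part of the marginal that depends
  on \<open>\<lambda>\<close> is nearly scale invariant. Put \<open>m = n + 1\<close>, and let all the \<open>\<lambda>\<^sub>i\<close> be of a common size \<open>s\<close>,
  that is, \<open>\<lambda>\<close> in the cube with sides from \<open>s\<close> to \<open>2 s\<close>. Restrict the inner integrals to
  \<open>1 \<le> \<tau> \<le> 2\<close> and \<open>\<bar>\<beta>\<^sub>i\<bar> \<le> r\<close>.

  If \<open>r \<le> 1\<close>, then \<open>(\<tau>, \<beta>)\<close> stays in a fixed compact set, on which the likelihood times the prior
  of \<open>\<tau>\<close> is continuous and positive, hence bounded below
  (\<open>likelihood_precision_prior_lower_bound\<close>). The values of \<open>c\<close>, \<open>d\<close>, the kernel and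
  the data affect the constant in this bound, but not its dependence on \<open>s\<close>.

  If \<open>s r\<^sup>2 \<le> 1\<close>, then the Gaussian exponent of \<open>\<beta>\<close> given \<open>\<lambda>\<close> is bounded, so this density is at least
  a constant times \<open>s\<close> to the power \<open>m / 2\<close>, and the prior of \<open>\<lambda>\<close> is at least a constant times \<open>s\<close>
  to the power \<open>m (a - 1)\<close> (\<open>coefficient_and_precision_prior_lower_bound\<close>).

  The box for \<open>\<beta>\<close> has volume \<open>(2 r)\<close> to the power \<open>m\<close>, and the cube for \<open>\<lambda>\<close> has volume \<open>s\<close> to the
  power \<open>m\<close>. The cube therefore contributes at least a constant times the \<open>m\<close>-th power of
  \<open>s powr (a - 1/2) * r * s\<close>. The best choice is \<open>r = min 1 (s powr (-1/2))\<close>: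
  for large \<open>s\<close> it gives \<open>s powr a\<close>, which is at least \<open>1\<close> when \<open>a \<ge> 0\<close>, and for small \<open>s\<close> it gives
  \<open>s powr (a + 1/2)\<close>, which is at least \<open>1\<close> when \<open>a \<le> -1/2\<close>. In either case the cubes at the
  infinitely many dyadic scales going to \<open>\<infinity>\<close>, respectively to \<open>0\<close>, are disjoint and each contributes
  a fixed amount, so the marginal is infinite (\<open>rvm_marginal_infinite\<close>).
\<close>

section \<open>Divergence from disjoint sets of equal mass\<close>

text \<open>The function equal to \<open>h j\<close> on each \<open>Q j\<close> and to \<open>0\<close> elsewhere is measurable and lies below \<open>f\<close>,
  and monotonicity of the integral holds for arbitrary functions. So the measurability of iterated
  integrals, here of the integrals over \<open>\<beta>\<close> and \<open>\<tau>\<close> as functions of \<open>\<lambda>\<close>, does not enter.\<close>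

lemma nn_integral_infinite_if_disjoint_lower_bounds:
  fixes Q :: "nat \<Rightarrow> 'a set" and f :: "'a \<Rightarrow> ennreal"
  assumes meas: "\<And>j. Q j \<in> sets M" and disj: "disjoint_family Q"
    and below: "\<And>j x. x \<in> Q j \<Longrightarrow> h j \<le> f x"
    and mass: "\<And>j. \<delta> \<le> h j * emeasure M (Q j)" and pos: "\<delta> > 0"
  shows "(\<integral>\<^sup>+x. f x \<partial>M) = \<infinity>"
proof -
  have pointwise: "(\<Sum>j. h j * indicator (Q j) x) \<le> f x" for x
  proof (cases "\<exists>i. x \<in> Q i")
    case True
    then obtain i where i: "x \<in> Q i" by blast
    then have "x \<notin> Q j" if "j \<noteq> i" for j
      using that disj by (auto simp: disjoint_family_on_def)
    then have "(\<Sum>j. h j * indicator (Q j) x) = (\<Sum>j\<in>{i}. h j * indicator (Q j) x)"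
      by (intro suminf_finite) auto
    then show ?thesis
      using below[OF i] i by simp
  next
    case False
    then show ?thesis by simp
  qed
  have "(\<Sum>j. \<delta>) \<le> (\<Sum>j. h j * emeasure M (Q j))"
    by (intro suminf_le mass summableI)
  also have "\<dots> = (\<integral>\<^sup>+x. (\<Sum>j. h j * indicator (Q j) x) \<partial>M)"
    using meas by (subst nn_integral_suminf) (auto simp: nn_integral_cmult_indicator)
  also have "\<dots> \<le> (\<integral>\<^sup>+x. f x \<partial>M)"
    by (intro nn_integral_mono pointwise)
  finally have "(\<Sum>j::nat. \<delta>) \<le> (\<integral>\<^sup>+x. f x \<partial>M)" .
  moreover have "(\<Sum>j::nat. \<delta>) = \<infinity>"
    using pos by (simp add: nn_integral_count_space_nat[symmetric] ennreal_mult_top)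
  ultimately show ?thesis
    by (simp add: top_unique)
qed

section \<open>Normal densities with diagonal covariance\<close>

lemma matrix_inv_diag_matrix:
  fixes v :: "real ^ 'm::finite"
  assumes "\<And>i. v $ i \<noteq> 0"
  shows "matrix_inv (diag_matrix v) = diag_matrix (\<chi> i. 1 / v $ i)"
proof -
  have prod: "diag_matrix u ** diag_matrix w = diag_matrix (\<chi> i. u $ i * w $ i)"
    for u w :: "real ^ 'm"
  proof -
    have "(\<Sum>k\<in>UNIV. (if i = k then u $ i else 0) * (if k = j then w $ k else 0))
        = (if i = j then u $ i * w $ i else 0)" for i j
      by (subst sum.mono_neutral_right[of UNIV "{i}"]) auto
    then show ?thesis
      by (simp add: diag_matrix_def matrix_matrix_mult_def vec_eq_iff)
  qed
  have one: "diag_matrix (\<chi> i. 1) = (mat 1 :: real ^ 'm ^ 'm)"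
    by (simp add: diag_matrix_def mat_def vec_eq_iff)
  let ?A = "diag_matrix v" and ?B = "diag_matrix (\<chi> i. 1 / v $ i)"
  have inv: "?A ** ?B = mat 1" "?B ** ?A = mat 1"
    using assms by (simp_all add: prod one)
  have "?A ** matrix_inv ?A = mat 1 \<and> matrix_inv ?A ** ?A = mat 1"
    unfolding matrix_inv_def by (rule someI[of _ ?B]) (simp add: inv)
  then have left: "matrix_inv ?A ** ?A = mat 1" ..
  have "matrix_inv ?A = matrix_inv ?A ** (?A ** ?B)"
    by (simp add: inv)
  also have "\<dots> = ?B"
    by (simp add: matrix_mul_assoc left)
  finally show ?thesis .
qed

lemma mvn_density_diag_matrix:
  fixes v x \<mu> :: "real ^ 'm::finite"
  assumes "\<And>i. v $ i \<noteq> 0"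
  shows "mvn_density \<mu> (diag_matrix v) x =
     exp (- (\<Sum>i\<in>UNIV. (x $ i - \<mu> $ i)\<^sup>2 / v $ i) / 2) / sqrt ((2 * pi) ^ CARD('m) * (\<Prod>i\<in>UNIV. v $ i))"
proof -
  have det: "det (diag_matrix v) = (\<Prod>i\<in>UNIV. v $ i)"
    by (subst det_diagonal) (auto simp: diag_matrix_def)
  have mul: "diag_matrix w *v z = (\<chi> i. w $ i * z $ i)" for w z :: "real ^ 'm"
    by (simp add: diag_matrix_def matrix_vector_mult_def vec_eq_iff if_distrib if_distribR sum.delta cong: if_cong)
  show ?thesis
    by (simp add: mvn_density_def det matrix_inv_diag_matrix[OF assms] mul inner_vec_def power2_eq_square)
qed

section \<open>Lower bounds on the factors of the integrand\<close>

text \<open>Over an interval of bounded ratio a power changes by a bounded factor, whatever the sign of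
  its exponent; so the constant does not depend on the scale \<open>s\<close>.\<close>

lemma gamma_prior_lower_bound:
  assumes "gamma_prior r 0 \<pi>"
  obtains \<kappa> where "\<kappa> > 0" "\<And>s t. 0 < s \<Longrightarrow> s < t \<Longrightarrow> t < 2 * s \<Longrightarrow> \<kappa> * s powr (r - 1) \<le> \<pi> t"
proof -
  obtain C where C: "C > 0" "\<And>t. t > 0 \<Longrightarrow> \<pi> t = C * t powr (r - 1)"
    using assms by (auto simp: gamma_prior_def proportional_on_def)
  have "C * min 1 (2 powr (r - 1)) * s powr (r - 1) \<le> \<pi> t" if "0 < s" "s < t" "t < 2 * s" for s t
  proof -
    have "min 1 (2 powr (r - 1)) * s powr (r - 1) \<le> t powr (r - 1)"
    proof (cases "r \<ge> 1")
      case True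
      have "min 1 (2 powr (r - 1)) * s powr (r - 1) \<le> 1 * s powr (r - 1)"
        by (intro mult_right_mono) auto
      also have "\<dots> \<le> t powr (r - 1)"
        using that True by (simp add: powr_mono2)
      finally show ?thesis .
    next
      case False
      have "min 1 (2 powr (r - 1)) * s powr (r - 1) \<le> 2 powr (r - 1) * s powr (r - 1)"
        by (intro mult_right_mono) auto
      also have "\<dots> = (2 * s) powr (r - 1)"
        using that by (simp add: powr_mult)
      also have "\<dots> \<le> t powr (r - 1)"
        using that False by (intro powr_mono2') auto
      finally show ?thesis .
    qed
    then show ?thesis
      using C that by (simp add: mult.assoc)
  qed
  moreover have "C * min 1 (2 powr (r - 1)) > 0"
    using C by simp
  ultimately show thesis
    using that by blast
qed

text \<open>A continuous positive function attains a positive minimum on a compact set. The interval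
  from \<open>1\<close> to \<open>2\<close> only has to stay away from \<open>0\<close>, where \<open>\<tau>\<close> may blow up or vanish as a power.\<close>

lemma likelihood_precision_prior_lower_bound:
  fixes K :: "real ^ 'n option ^ 'n::finite"
  assumes "gamma_prior c d p_tau"
  shows "\<exists>A>0. \<forall>\<tau>\<in>{1..2}. \<forall>\<beta>\<in>cbox (- 1) 1. A \<le> rvm_likelihood K y \<beta> (1 / \<tau>) * p_tau \<tau>"
proof -
  obtain C where C: "C > 0" "\<And>t. t > 0 \<Longrightarrow> p_tau t = C * (t powr (c - 1) * exp (- d * t))"
    using assms by (auto simp: gamma_prior_def proportional_on_def)
  define F where "F = (\<lambda>(\<tau>, \<beta>). exp (- (\<Sum>i\<in>UNIV. (y $ i - (K *v \<beta>) $ i)\<^sup>2 * \<tau>) / 2)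
      / sqrt ((2 * pi) ^ CARD('n) * (1 / \<tau>) ^ CARD('n)) * (C * (\<tau> powr (c - 1) * exp (- d * \<tau>))))"
  have F: "rvm_likelihood K y \<beta> (1 / \<tau>) * p_tau \<tau> = F (\<tau>, \<beta>)" if "\<tau> > 0" for \<tau> \<beta>
  proof -
    have "(1 / \<tau>) *\<^sub>R mat 1 = (diag_matrix (\<chi> i. 1 / \<tau>) :: real ^ 'n ^ 'n)"
      by (simp add: diag_matrix_def mat_def vec_eq_iff)
    then show ?thesis
      using that by (simp add: rvm_likelihood_def mvn_density_diag_matrix C F_def)
  qed
  have "continuous_on ({1..2} \<times> S) F" for S
  proof -
    have fit: "continuous_on ({1..2::real} \<times> S) (\<lambda>z. K *v snd z)"
      by (intro bounded_linear.continuous_on[OF matrix_vector_mul_bounded_linear] continuous_intros)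
    have numerator: "continuous_on ({1..2::real} \<times> S)
        (\<lambda>z. exp (- (\<Sum>i\<in>UNIV. (y $ i - (K *v snd z) $ i)\<^sup>2 * fst z) / 2))"
      by (intro continuous_on_exp continuous_on_divide continuous_on_minus continuous_on_sum continuous_on_mult
          continuous_on_power continuous_on_diff continuous_on_const continuous_on_component fit
          continuous_on_fst continuous_on_id) auto
    have denominator: "continuous_on ({1..2::real} \<times> S)
        (\<lambda>z. sqrt ((2 * pi) ^ CARD('n) * (1 / fst z) ^ CARD('n)))"
      by (intro continuous_intros) auto
    have prior: "continuous_on ({1..2::real} \<times> S)
        (\<lambda>z. C * (fst z powr (c - 1) * exp (- d * fst z)))"
      by (intro continuous_intros) auto
    show ?thesis
      unfolding F_def case_prod_beta
      by (rule continuous_on_mult[OF continuous_on_divide[OF numerator denominator] prior]) auto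
  qed
  moreover have "compact ({1..2::real} \<times> cbox (- 1) (1 :: real ^ 'n option))"
    by (intro compact_Times) auto
  moreover have "(1, 0) \<in> {1..2::real} \<times> cbox (- 1) (1 :: real ^ 'n option)"
    by (simp add: mem_box_cart)
  ultimately obtain p where p: "p \<in> {1..2} \<times> cbox (- 1) 1"
      and min: "\<And>q. q \<in> {1..2} \<times> cbox (- 1) 1 \<Longrightarrow> F p \<le> F q"
    using continuous_attains_inf[of "{1..2::real} \<times> cbox (- 1) (1 :: real ^ 'n option)" F] by blast
  have "F p > 0"
    using p C(1) by (cases p) (simp add: F_def)
  moreover have "F p \<le> rvm_likelihood K y \<beta> (1 / \<tau>) * p_tau \<tau>"
    if "\<tau> \<in> {1..2}" "\<beta> \<in> cbox (- 1) 1" for \<tau> \<beta>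
    using min[of "(\<tau>, \<beta>)"] that by (simp add: F)
  ultimately show ?thesis
    by blast
qed

text \<open>The condition \<open>s * r\<^sup>2 \<le> 1\<close> keeps \<open>\<beta>\<close> within a bounded number of standard deviations of \<open>0\<close>, so
  only the normalising factor of the Gaussian, of order \<open>sqrt s\<close> per coordinate, depends on the scale;
  together with the factor \<open>s powr (a - 1)\<close> of the prior it gives the exponent \<open>a - 1/2\<close>.\<close>

lemma coefficient_and_precision_prior_lower_bound:
  fixes p_lam :: "'m::finite \<Rightarrow> real \<Rightarrow> real"
  assumes "\<And>i. gamma_prior a 0 (p_lam i)"
  shows "\<exists>B>0. \<forall>s r lam \<beta>. 0 < s \<longrightarrow> s * r\<^sup>2 \<le> 1 \<longrightarrow>
      (\<forall>i. s < lam $ i \<and> lam $ i < 2 * s) \<longrightarrow> (\<forall>i. \<bar>\<beta> $ i\<bar> \<le> r) \<longrightarrow>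
      B * (s powr (a - 1 / 2)) ^ CARD('m)
        \<le> mvn_density 0 (matrix_inv (diag_matrix lam)) \<beta> * (\<Prod>i\<in>UNIV. p_lam i (lam $ i))"
proof -
  let ?m = "CARD('m)"
  have "\<exists>\<kappa>>0. \<forall>s t. 0 < s \<longrightarrow> s < t \<longrightarrow> t < 2 * s \<longrightarrow> \<kappa> * s powr (a - 1) \<le> p_lam i t" for i
    using gamma_prior_lower_bound[OF assms[of i]] by metis
  then obtain \<kappa> where \<kappa>: "\<And>i. \<kappa> i > 0"
      "\<And>i s t. 0 < s \<Longrightarrow> s < t \<Longrightarrow> t < 2 * s \<Longrightarrow> \<kappa> i * s powr (a - 1) \<le> p_lam i t"
    by metis
  \<comment> \<open>Each \<open>(\<beta> $ i)\<^sup>2 * lam $ i\<close> is at most \<open>2\<close>, so half their sum is at most the dimension.\<close>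
  define E where "E = exp (- real ?m) / sqrt ((2 * pi) ^ ?m)"
  have "E * (\<Prod>i\<in>UNIV. \<kappa> i) * (s powr (a - 1 / 2)) ^ ?m
      \<le> mvn_density 0 (matrix_inv (diag_matrix lam)) \<beta> * (\<Prod>i\<in>UNIV. p_lam i (lam $ i))"
    if s: "0 < s" and r: "s * r\<^sup>2 \<le> 1" and lam: "\<And>i. s < lam $ i \<and> lam $ i < 2 * s"
      and \<beta>: "\<And>i. \<bar>\<beta> $ i\<bar> \<le> r" for s r lam \<beta>
  proof -
    have lam_pos: "lam $ i > 0" for i
      using lam[of i] s by linarith
    have "\<beta> $ i ^ 2 * lam $ i \<le> 2" for i
    proof -
      have "\<beta> $ i ^ 2 * lam $ i \<le> r\<^sup>2 * (2 * s)"
        using \<beta>[of i] lam[of i] s by (intro mult_mono) (auto simp: power2_le_iff_abs_le)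
      then show ?thesis
        using r by (simp add: mult.commute)
    qed
    then have "(\<Sum>i\<in>UNIV. \<beta> $ i ^ 2 * lam $ i) \<le> (\<Sum>i\<in>(UNIV::'m set). 2)"
      by (intro sum_mono)
    then have expo: "exp (- real ?m) \<le> exp (- (\<Sum>i\<in>UNIV. \<beta> $ i ^ 2 * lam $ i) / 2)"
      by simp
    have "sqrt s ^ ?m = sqrt (\<Prod>i\<in>(UNIV::'m set). s)"
      by (simp add: real_sqrt_power)
    also have "\<dots> \<le> sqrt (\<Prod>i\<in>UNIV. lam $ i)"
      using lam s by (intro real_sqrt_le_mono prod_mono) (auto intro: less_imp_le)
    finally have root: "sqrt s ^ ?m \<le> sqrt (\<Prod>i\<in>UNIV. lam $ i)" .
    have "mvn_density 0 (matrix_inv (diag_matrix lam)) \<beta>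
      = exp (- (\<Sum>i\<in>UNIV. \<beta> $ i ^ 2 * lam $ i) / 2) / sqrt ((2 * pi) ^ ?m) * sqrt (\<Prod>i\<in>UNIV. lam $ i)"
      using lam_pos
      by (simp add: matrix_inv_diag_matrix mvn_density_diag_matrix less_imp_neq[THEN not_sym]
          prod_dividef real_sqrt_mult real_sqrt_divide)
    also have "\<dots> \<ge> E * sqrt s ^ ?m"
      unfolding E_def using expo root s
      by (intro mult_mono divide_right_mono) (auto intro!: divide_nonneg_nonneg)
    finally have gauss: "E * sqrt s ^ ?m \<le> mvn_density 0 (matrix_inv (diag_matrix lam)) \<beta>" .
    have "(\<Prod>i\<in>UNIV. \<kappa> i) * (s powr (a - 1)) ^ ?m = (\<Prod>i\<in>UNIV. \<kappa> i * s powr (a - 1))"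
      by (simp add: prod.distrib)
    also have "\<dots> \<le> (\<Prod>i\<in>UNIV. p_lam i (lam $ i))"
      using \<kappa> s lam by (intro prod_mono) (auto simp: less_imp_le)
    finally have prior: "(\<Prod>i\<in>UNIV. \<kappa> i) * (s powr (a - 1)) ^ ?m \<le> (\<Prod>i\<in>UNIV. p_lam i (lam $ i))" .
    have "s powr (a - 1 / 2) = sqrt s * s powr (a - 1)"
      using s by (simp add: powr_half_sqrt[symmetric] powr_add[symmetric])
    then have "E * (\<Prod>i\<in>UNIV. \<kappa> i) * (s powr (a - 1 / 2)) ^ ?m
      = (E * sqrt s ^ ?m) * ((\<Prod>i\<in>UNIV. \<kappa> i) * (s powr (a - 1)) ^ ?m)"
      by (simp add: power_mult_distrib)
    also have "\<dots> \<le> mvn_density 0 (matrix_inv (diag_matrix lam)) \<beta> * (\<Prod>i\<in>UNIV. p_lam i (lam $ i))"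
    proof (intro mult_mono gauss prior)
      show "0 \<le> mvn_density 0 (matrix_inv (diag_matrix lam)) \<beta>"
        by (rule order_trans[OF _ gauss]) (use s in \<open>simp add: E_def\<close>)
      show "0 \<le> (\<Prod>i\<in>UNIV. \<kappa> i) * (s powr (a - 1)) ^ ?m"
        using \<kappa> by (intro mult_nonneg_nonneg prod_nonneg) (auto simp: less_imp_le)
    qed
    finally show ?thesis .
  qed
  moreover have "E * (\<Prod>i\<in>UNIV. \<kappa> i) > 0"
    using \<kappa> by (simp add: E_def prod_pos)
  ultimately show ?thesis
    by blast
qed

section \<open>Infinite marginals\<close>

lemma emeasure_lborel_cube_cart:
  fixes u v :: real
  assumes "u \<le> v"
  shows "emeasure lborel (cbox (vec u) (vec v :: real ^ 'm)) = ennreal ((v - u) ^ CARD('m))"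
    and "emeasure lborel (box (vec u) (vec v :: real ^ 'm)) = ennreal ((v - u) ^ CARD('m))"
proof -
  let ?C = "cbox (vec u) (vec v :: real ^ 'm)"
  have ne: "?C \<noteq> {}"
    using assms by (auto simp: interval_ne_empty_cart)
  have "emeasure lborel ?C = ennreal (measure lborel ?C)"
    using emeasure_lborel_cbox_finite by (intro emeasure_eq_ennreal_measure) (auto simp: less_top)
  also have "measure lborel ?C = (v - u) ^ CARD('m)"
    using ne by (simp add: content_cbox_cart)
  finally show cbox: "emeasure lborel ?C = ennreal ((v - u) ^ CARD('m))" .
  show "emeasure lborel (box (vec u) (vec v :: real ^ 'm)) = ennreal ((v - u) ^ CARD('m))"
    using cbox by (simp only: emeasure_lborel_box_eq emeasure_lborel_cbox_eq)
qed

text \<open>This is the criterion behind both boundary cases: \<open>s j\<close> is the scale of the \<open>j\<close>-th cube for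
  \<open>\<lambda>\<close>, and \<open>r j\<close> is the half-width of the box for \<open>\<beta>\<close>. The hypothesis \<open>mass\<close> says that the powers of
  the scale in the two densities and the two volumes do not let the contribution of a cube decay, and
  \<open>sep\<close> makes the cubes disjoint.\<close>

lemma rvm_marginal_infinite:
  fixes K :: "real ^ 'n option ^ 'n::finite" and s r :: "nat \<Rightarrow> real"
  assumes lam: "\<And>i. gamma_prior a 0 (p_lam i)" and tau: "gamma_prior c d p_tau"
    and s: "\<And>j. s j > 0" and r: "\<And>j. 0 < r j" "\<And>j. r j \<le> 1" "\<And>j. s j * (r j)\<^sup>2 \<le> 1"
    and mass: "\<And>j. 1 \<le> s j powr (a - 1 / 2) * r j * s j"
    and sep: "\<And>j l. j < l \<Longrightarrow> 2 * s j \<le> s l \<or> 2 * s l \<le> s j"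
  shows "rvm_marginal K p_lam p_tau y = \<infinity>"
proof -
  let ?m = "CARD('n option)"
  obtain A where A: "A > 0"
    "\<And>\<tau> \<beta>. \<tau> \<in> {1..2} \<Longrightarrow> \<beta> \<in> cbox (- 1) 1 \<Longrightarrow> A \<le> rvm_likelihood K y \<beta> (1 / \<tau>) * p_tau \<tau>"
    using likelihood_precision_prior_lower_bound[OF tau, of K y] by blast
  obtain B where B: "B > 0"
    "\<And>s r lam \<beta>. 0 < s \<Longrightarrow> s * r\<^sup>2 \<le> 1 \<Longrightarrow> (\<And>i. s < lam $ i \<and> lam $ i < 2 * s) \<Longrightarrow> (\<And>i. \<bar>\<beta> $ i\<bar> \<le> r) \<Longrightarrow>
      B * (s powr (a - 1 / 2)) ^ ?m
        \<le> mvn_density 0 (matrix_inv (diag_matrix lam)) \<beta> * (\<Prod>i\<in>UNIV. p_lam i (lam $ i))"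
    using coefficient_and_precision_prior_lower_bound[of a p_lam, OF lam] by blast
  define Q where "Q j = box (vec (s j)) (vec (2 * s j) :: real ^ 'n option)" for j
  have Q: "lam \<in> Q j \<longleftrightarrow> (\<forall>i. s j < lam $ i \<and> lam $ i < 2 * s j)" for lam j
    by (auto simp: Q_def mem_box_cart)
  define w where "w j = A * (B * (s j powr (a - 1 / 2)) ^ ?m)" for j
  define h where "h j = w j * (2 * r j) ^ ?m" for j
  define f where "f lam \<tau> \<beta> = rvm_likelihood K y \<beta> (1 / \<tau>) * rvm_prior p_lam p_tau \<beta> \<tau> lam" for lam \<tau> \<beta>
  have w_pos: "w j > 0" for j
    using A(1) B(1) s[of j] by (simp add: w_def)
  have w: "w j \<le> f lam \<tau> \<beta>"
    if "lam \<in> Q j" "\<tau> \<in> {1..2}" "\<beta> \<in> cbox (vec (- r j)) (vec (r j))" for j lam \<tau> \<beta>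
  proof -
    have \<beta>: "\<bar>\<beta> $ i\<bar> \<le> r j" for i
      using that(3) by (force simp: mem_box_cart abs_le_iff minus_le_iff)
    then have "\<bar>\<beta> $ i\<bar> \<le> 1" for i
      using r(2)[of j] order_trans by blast
    then have "\<beta> \<in> cbox (- 1) 1"
      by (force simp: mem_box_cart abs_le_iff minus_le_iff)
    then have "w j \<le> (rvm_likelihood K y \<beta> (1 / \<tau>) * p_tau \<tau>)
        * (mvn_density 0 (matrix_inv (diag_matrix lam)) \<beta> * (\<Prod>i\<in>UNIV. p_lam i (lam $ i)))"
      unfolding w_def using A(1) B(1) that(1) \<beta> s[of j]
      by (intro mult_mono A(2) B(2)[OF s r(3)] that(2))
        (auto simp: Q intro: order_trans[OF less_imp_le A(2)[OF that(2)]])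
    then show ?thesis
      by (simp add: f_def rvm_prior_def mult_ac)
  qed
  have inner: "ennreal (h j) \<le> (\<integral>\<^sup>+\<beta>. ennreal (f lam \<tau> \<beta>) \<partial>lborel)"
    if "lam \<in> Q j" "\<tau> \<in> {1..2}" for j lam \<tau>
  proof -
    have "ennreal (h j)
        = (\<integral>\<^sup>+\<beta>. ennreal (w j) * indicator (cbox (vec (- r j)) (vec (r j) :: real ^ 'n option)) \<beta> \<partial>lborel)"
      using r(1)[of j] w_pos[of j] emeasure_lborel_cube_cart(1)[of "- r j" "r j", where 'm = "'n option"]
      by (subst nn_integral_cmult_indicator) (simp_all add: h_def ennreal_mult)
    also have "\<dots> \<le> (\<integral>\<^sup>+\<beta>. ennreal (f lam \<tau> \<beta>) \<partial>lborel)"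
      by (intro nn_integral_mono) (auto simp: indicator_def w[OF that] ennreal_leI)
    finally show ?thesis .
  qed
  have middle: "ennreal (h j) \<le> (\<integral>\<^sup>+\<tau>\<in>{0<..}. (\<integral>\<^sup>+\<beta>. ennreal (f lam \<tau> \<beta>) \<partial>lborel) \<partial>lborel)"
    if "lam \<in> Q j" for j lam
  proof -
    have "ennreal (h j) = (\<integral>\<^sup>+\<tau>. ennreal (h j) * indicator {1..2::real} \<tau> \<partial>lborel)"
      by (subst nn_integral_cmult_indicator) simp_all
    also have "\<dots> \<le> (\<integral>\<^sup>+\<tau>\<in>{0<..}. (\<integral>\<^sup>+\<beta>. ennreal (f lam \<tau> \<beta>) \<partial>lborel) \<partial>lborel)"
      by (intro nn_integral_mono) (auto simp: indicator_def inner[OF that])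
    finally show ?thesis .
  qed
  have "(\<integral>\<^sup>+lam\<in>{lam. \<forall>i. 0 < lam $ i}. (\<integral>\<^sup>+\<tau>\<in>{0<..}. (\<integral>\<^sup>+\<beta>. ennreal (f lam \<tau> \<beta>) \<partial>lborel) \<partial>lborel) \<partial>lborel) = \<infinity>"
  proof (rule nn_integral_infinite_if_disjoint_lower_bounds)
    show "Q j \<in> sets lborel" for j
      by (simp add: Q_def)
    show "disjoint_family Q"
      unfolding disjoint_family_on_def
    proof (intro ballI impI)
      fix j l :: nat assume "j \<noteq> l"
      then have "2 * s j \<le> s l \<or> 2 * s l \<le> s j"
        using sep[of j l] sep[of l j] by (cases "j < l") auto
      moreover have "s j < lam $ None \<and> lam $ None < 2 * s j \<and> s l < lam $ None \<and> lam $ None < 2 * s l"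
        if "lam \<in> Q j \<inter> Q l" for lam
        using that by (simp add: Q)
      ultimately show "Q j \<inter> Q l = {}"
        by (fastforce simp: disjoint_iff)
    qed
    show "ennreal (h j) \<le> (\<integral>\<^sup>+\<tau>\<in>{0<..}. (\<integral>\<^sup>+\<beta>. ennreal (f lam \<tau> \<beta>) \<partial>lborel) \<partial>lborel)
        * indicator {lam. \<forall>i. 0 < lam $ i} lam" if "lam \<in> Q j" for j lam
    proof -
      have "0 < lam $ i" for i
        using that s[of j] by (meson Q order_less_trans)
      then show ?thesis
        using middle[OF that] by simp
    qed
    show "ennreal (A * B * 2 ^ ?m) \<le> ennreal (h j) * emeasure lborel (Q j)" for j
    proof -
      have "A * B * 2 ^ ?m * 1 \<le> A * B * 2 ^ ?m * (s j powr (a - 1 / 2) * r j * s j) ^ ?m"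
        using A(1) B(1) mass by (intro mult_left_mono one_le_power) auto
      also have "\<dots> = h j * s j ^ ?m"
        by (simp add: h_def w_def power_mult_distrib mult_ac)
      also have "ennreal \<dots> = ennreal (h j) * emeasure lborel (Q j)"
        unfolding Q_def using s[of j] r(1)[of j] w_pos[of j]
        by (subst emeasure_lborel_cube_cart(2)) (simp_all add: ennreal_mult h_def)
      finally show ?thesis
        by (simp add: ennreal_leI)
    qed
    show "ennreal (A * B * 2 ^ ?m) > 0"
      using A(1) B(1) by simp
  qed
  then show ?thesis
    by (simp add: rvm_marginal_def f_def)
qed

theorem theorem2p1:
  fixes k :: "'\<theta> \<Rightarrow> real ^ 'p \<Rightarrow> real ^ 'p \<Rightarrow> real"
    and \<theta> :: "'\<theta>"
    and x :: "'n::finite \<Rightarrow> real ^ 'p"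
    and y :: "real ^ 'n"
    and a b c d :: real
    and p_lam :: "'n option \<Rightarrow> real \<Rightarrow> real"
    and p_tau :: "real \<Rightarrow> real"
  assumes kernel: "reproducing_kernel (k \<theta>)"
    and prior_lambda: "\<And>i. gamma_prior a b (p_lam i)"
    and prior_precision: "gamma_prior c d p_tau"
    and b_zero: "b = 0"
    and proper: "rvm_posterior_proper (design_matrix (k \<theta>) x) p_lam p_tau y"
  shows "a \<in> {-1/2<..<0}"
proof (rule ccontr)
  assume "a \<notin> {-1/2<..<0}"
  then consider "a \<ge> 0" | "a \<le> -1/2" by force
  then have "rvm_marginal (design_matrix (k \<theta>) x) p_lam p_tau y = \<infinity>"
  proof cases
    case 1
    \<comment> \<open>Large precisions: \<open>\<beta>\<close> concentrates at \<open>0\<close> with standard deviation \<open>s powr (-1/2)\<close>.\<close>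
    let ?s = "\<lambda>j::nat. 2 ^ j :: real"
    show ?thesis
    proof (rule rvm_marginal_infinite[where s = ?s and r = "\<lambda>j. ?s j powr (-1/2)"])
      show "gamma_prior a 0 (p_lam i)" for i
        using prior_lambda b_zero by simp
      show "?s j powr (-1/2) \<le> 1" for j
        using powr_mono2'[of "-1/2" 1 "?s j"] by simp
      have "?s j powr 1 * (?s j powr (-1/2))\<^sup>2 = 1" for j
        by (simp only: power2_eq_square powr_add[symmetric]) simp
      then show "?s j * (?s j powr (-1/2))\<^sup>2 \<le> 1" for j
        by simp
      have "?s j powr (a - 1 / 2) * ?s j powr (-1/2) * ?s j powr 1 = ?s j powr a" for j
        by (simp only: powr_add[symmetric]) simp
      then show "1 \<le> ?s j powr (a - 1 / 2) * ?s j powr (-1/2) * ?s j" for j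
        using 1 by (simp add: ge_one_powr_ge_zero)
      show "2 * ?s j \<le> ?s l \<or> 2 * ?s l \<le> ?s j" if "j < l" for j l
        using power_increasing[of "Suc j" l "2 :: real"] that by simp
    qed (auto intro!: prior_precision)
  next
    case 2
    \<comment> \<open>Small precisions: the density of \<open>\<beta>\<close> is flat on the unit box, of height about \<open>sqrt s\<close>
      per coordinate.\<close>
    let ?s = "\<lambda>j::nat. (1/2) ^ j :: real"
    show ?thesis
    proof (rule rvm_marginal_infinite[where s = ?s and r = "\<lambda>j. 1"])
      show "gamma_prior a 0 (p_lam i)" for i
        using prior_lambda b_zero by simp
      have "?s j powr (a - 1 / 2) * ?s j powr 1 = ?s j powr (a + 1 / 2)" for j
        by (simp only: powr_add[symmetric]) (simp add: add.commute)
      moreover have "1 \<le> ?s j powr (a + 1 / 2)" for j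
        using powr_mono2'[of "a + 1/2" "?s j" 1] 2 by (simp add: power_le_one)
      ultimately show "1 \<le> ?s j powr (a - 1 / 2) * 1 * ?s j" for j
        by simp
      show "2 * ?s j \<le> ?s l \<or> 2 * ?s l \<le> ?s j" if "j < l" for j l
        using power_decreasing[of "Suc j" l "1 / 2 :: real"] that by simp
    qed (auto intro!: prior_precision simp: power_le_one)
  qed
  then show False
    using proper by (simp add: rvm_posterior_proper_def)
qed

end
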